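(* For all $z\in\mathbb{C}$ and all real $-\tfrac12<x<1$, $$\sum_{n=1}^{\infty}\binom{z}{n}H_n x^n=(x+1)^z F\!\left(z,\frac{x}{x+1}\right).$$ When $0<x<1$ and $z\notin\{-1,-2,\dots\}$, $$\sum_{n=1}^{\infty}\binom{z}{n}H_n x^n=(x+1)^z\left(\psi(z+1)+\gamma+\log\frac{x}{1+x}+\sum_{n=1}^{\infty}\frac{1}{(1+x)^{n+z}(n+z)}\right).$$ Also, for all $z\in\mathbb{C}$ and real $|x|<1$, $$\sum_{n=1}^{\infty}\binom{n+z}{n}H_n x^n=(1-x)^{-z-1}\big[F(z,x)-\log(1-x)\big].$$
   Context: For $z\in\mathbb{C}$ and $|x|<1$, $F(z,x)=\sum_{n=1}^{\infty}\binom{z}{n}\frac{(-1)^{n-1}x^n}{n}$, where $\binom{z}{n}=\frac{z(z-1)\cdots(z-n+1)}{n!}$. $H_n=\sum_{k=1}^n\frac1k$ are the harmonic numbers ($H_0=0$). $\psi=\Gamma'/\Gamma$ is the digamma function, $\gamma$ Euler's constant. Powers of positive reals use the real logarithm. *)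

theory Defs
  imports "HOL-Analysis.Analysis"
begin

(* All series over n >= 1 are re-indexed by n = Suc k; hence the sign (-1)^(n-1) is (-1)^k. *)

definition F :: "complex \<Rightarrow> complex \<Rightarrow> complex" where
  "F z x = (\<Sum>k. (z gchoose Suc k) * ((-1) ^ k * x ^ Suc k / of_nat (Suc k)))"

(* The infinite sum defining F is a genuine limit on the unit disc. *)
lemma summable_F:
  fixes z x :: complex
  assumes "norm x < 1"
  shows "summable (\<lambda>k. (z gchoose Suc k) * ((-1) ^ k * x ^ Suc k / of_nat (Suc k)))"
proof -
  obtain r where r: "norm x < r" "r < 1"
    using assms dense by blast
  have "r > 0"
    using r(1) norm_ge_zero[of x] by linarith
  have "summable (\<lambda>n. (z gchoose n) * complex_of_real r ^ n)"
    by (rule sums_summable, rule gen_binomial_complex) (use r \<open>r > 0\<close> in auto)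
  then have "summable (\<lambda>n. norm ((z gchoose n) * x ^ n))"
    by (rule powser_insidea) (use r \<open>r > 0\<close> in auto)
  then have s: "summable (\<lambda>k. norm ((z gchoose Suc k) * x ^ Suc k))"
    by (subst summable_Suc_iff)
  have "norm ((z gchoose Suc k) * ((-1) ^ k * x ^ Suc k / of_nat (Suc k)))
          \<le> norm ((z gchoose Suc k) * x ^ Suc k)" for k
  proof -
    have "norm ((z gchoose Suc k) * ((-1) ^ k * x ^ Suc k / of_nat (Suc k)))
        = norm ((z gchoose Suc k) * x ^ Suc k) / real (Suc k)"
      by (simp only: norm_mult norm_divide norm_power norm_minus_cancel norm_one
            power_one norm_of_nat mult_1 times_divide_eq_right)
    also have "\<dots> \<le> norm ((z gchoose Suc k) * x ^ Suc k) / 1"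
      by (rule divide_left_mono) auto
    finally show ?thesis by simp
  qed
  then show ?thesis
    by (intro summable_comparison_test[OF _ s]) blast
qed

end

theory Submission
  imports Defs "HOL-Real_Asymp.Real_Asymp"
begin

text \<open>
  Write $G(z,x)$ for the series with coefficients ${z \choose n} H_n$ and
  $B(z,x) = ((1+x)^z - 1)/x$. Comparing coefficients gives
  $(1+x) G' = z G + B$, so $(1+x)^{-z} G(z,x)$ has derivative $(1+x)^{-z-1} B(z,x)$, while
  $F(z,x)$ has derivative $B(z,-x)$. The first identity then holds because both sides agree at $0$
  and have the same derivative on the convex domain of the unit disc where $\mathrm{Re}\, x > -1/2$;
  the third follows in the same way from $G(-z-1,-x)$.
  For the second, put $v = 1/(1+x)$. On the lens $|v| < 1$, $|1-v| < 1$ the function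
  $F(z,1-v) - \log(1-v) - \sum_{n \ge 1} v^{n+z}/(n+z)$ has derivative zero. Its constant value
  is found by letting $v$ tend to $1$: since $1/(n+z) = 1/n - (1/n - 1/(n+z))$, the logarithms cancel
  up to $(1-v^z)\log(1-v)$, which tends to $0$, and what remains is the series for $\psi(z+1)+\gamma$.
\<close>

section \<open>Auxiliary power series and termwise calculus on the unit disc\<close>

text \<open>This is B(z,x) = ((1+x)^z - 1)/x, encoded as a series so that the removable singularity
  at 0 is already filled in with the value z.\<close>

definition gbinomial_quotient :: "complex \<Rightarrow> complex \<Rightarrow> complex" where
  "gbinomial_quotient z x = (\<Sum>n. (z gchoose Suc n) * x ^ n)"

text \<open>This is G(z,x). The sum starts at n = 0, where \<open>harm 0 = 0\<close>, so that it is
  an ordinary power series.\<close>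

definition harm_binomial_series :: "complex \<Rightarrow> complex \<Rightarrow> complex" where
  "harm_binomial_series z x = (\<Sum>n. ((z gchoose n) * harm n) * x ^ n)"

lemma one_plus_notin_nonpos_Reals:
  fixes x :: complex
  assumes "norm x < 1"
  shows "1 + x \<notin> \<real>\<^sub>\<le>\<^sub>0"
proof -
  have "\<bar>Re x\<bar> < 1" using abs_Re_le_cmod[of x] assms by linarith
  then show ?thesis by (auto simp: complex_nonpos_Reals_iff)
qed

text \<open>Convergence at some radius r strictly between |x| and 1 forces absolute convergence at
  x.\<close>

lemma summable_norm_powser:
  fixes c :: "nat \<Rightarrow> complex"
  assumes "\<And>x. norm x < 1 \<Longrightarrow> summable (\<lambda>n. c n * x ^ n)" and "norm x < 1"
  shows "summable (\<lambda>n. norm (c n * x ^ n))"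
proof -
  obtain r where r: "norm x < r" "r < 1" using assms(2) dense by blast
  have "r > 0" using r(1) norm_ge_zero[of x] by linarith
  have "summable (\<lambda>n. c n * of_real r ^ n)"
    by (rule assms(1)) (use r \<open>r > 0\<close> in auto)
  then show ?thesis
    by (rule powser_insidea) (use r \<open>r > 0\<close> in auto)
qed

lemma summable_diffs_powser:
  fixes c :: "nat \<Rightarrow> complex"
  assumes "\<And>x. norm x < 1 \<Longrightarrow> summable (\<lambda>n. c n * x ^ n)" and "norm x < 1"
  shows "summable (\<lambda>n. diffs c n * x ^ n)"
  using termdiff_converges[of x 1 c] assms by auto

lemma DERIV_powser:
  fixes c :: "nat \<Rightarrow> complex"
  assumes "\<And>x. norm x < 1 \<Longrightarrow> summable (\<lambda>n. c n * x ^ n)" and "norm x < 1"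
  shows "((\<lambda>x. \<Sum>n. c n * x ^ n) has_field_derivative (\<Sum>n. diffs c n * x ^ n)) (at x)"
  using termdiffs_strong'[of 1 c x] assms by simp

lemma summable_gbinomial:
  fixes z x :: complex
  assumes "norm x < 1"
  shows "summable (\<lambda>n. (z gchoose n) * x ^ n)"
  using gen_binomial_complex[OF assms] by (rule sums_summable)

text \<open>Dropping the constant term of the binomial series leaves x times the quotient. The form
  without division also covers x = 0.\<close>

lemma gbinomial_quotient_mult:
  assumes "norm x < 1"
  shows "x * gbinomial_quotient z x = (1 + x) powr z - 1"
proof (cases "x = 0")
  case False
  have "(\<lambda>n. (z gchoose Suc n) * x ^ Suc n) sums ((1 + x) powr z - (z gchoose 0) * x ^ 0)"
    using gen_binomial_complex[OF assms, of z] by (subst sums_Suc_iff) simp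
  then have "(\<lambda>n. (z gchoose Suc n) * x ^ Suc n * inverse x) sums (((1 + x) powr z - 1) * inverse x)"
    by (intro sums_mult2) simp
  also have "(\<lambda>n. (z gchoose Suc n) * x ^ Suc n * inverse x) = (\<lambda>n. (z gchoose Suc n) * x ^ n)"
    using False by (simp add: field_simps)
  finally have "gbinomial_quotient z x = ((1 + x) powr z - 1) * inverse x"
    unfolding gbinomial_quotient_def by (rule sums_unique[symmetric])
  then show ?thesis using False by simp
qed simp

lemma gbinomial_quotient_0: "gbinomial_quotient z 0 = z"
  unfolding gbinomial_quotient_def using powser_zero[of "\<lambda>n. z gchoose Suc n"] by simp

lemma summable_gbinomial_quotient:
  fixes z x :: complex
  assumes "norm x < 1"
  shows "summable (\<lambda>n. (z gchoose Suc n) * x ^ n)"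
proof (cases "x = 0")
  case False
  have "summable (\<lambda>n. (z gchoose Suc n) * x ^ Suc n)"
    using summable_gbinomial[OF assms, of z] by (subst summable_Suc_iff)
  then have "summable (\<lambda>n. (z gchoose Suc n) * x ^ Suc n * inverse x)"
    by (rule summable_mult2)
  then show ?thesis using False by (simp add: field_simps)
qed (simp add: summable_0_powser)

section \<open>The series \<open>F\<close> as a primitive of the binomial quotient\<close>

text \<open>Brings \<open>F\<close> into the form required by termwise differentiation. The sign
  (-1)^(n-1) becomes \<open>- ((-1) ^ n)\<close>, and the added term at n = 0 vanishes because
  division by zero gives 0.\<close>

lemma F_eq_powser:
  assumes "norm x < 1"
  shows "F z x = (\<Sum>n. ((z gchoose n) * (- ((-1) ^ n)) / of_nat n) * x ^ n)"
    and "summable (\<lambda>n. ((z gchoose n) * (- ((-1) ^ n)) / of_nat n) * x ^ n)"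
proof -
  define c where "c = (\<lambda>n. ((z gchoose n) * (- ((-1) ^ n)) / of_nat n) * x ^ n)"
  have c: "(\<lambda>k. (z gchoose Suc k) * ((-1) ^ k * x ^ Suc k / of_nat (Suc k))) = (\<lambda>k. c (Suc k))"
    unfolding c_def by (simp add: fun_eq_iff)
  have "summable (\<lambda>k. c (Suc k))"
    using summable_F[OF assms, of z] unfolding c .
  then have s: "summable c" by (subst (asm) summable_Suc_iff)
  then show "summable (\<lambda>n. ((z gchoose n) * (- ((-1) ^ n)) / of_nat n) * x ^ n)"
    unfolding c_def .
  show "F z x = (\<Sum>n. ((z gchoose n) * (- ((-1) ^ n)) / of_nat n) * x ^ n)"
    unfolding F_def c c_def[symmetric] using suminf_split_head[OF s] by (simp add: c_def)
qed

lemma F_0: "F z 0 = 0"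
  unfolding F_def by simp

text \<open>Differentiation cancels the denominator n, and the alternating sign is absorbed into the
  power of -x.\<close>

lemma DERIV_F:
  assumes "norm x < 1"
  shows "(F z has_field_derivative gbinomial_quotient z (- x)) (at x)"
proof -
  define c where "c = (\<lambda>n. (z gchoose n) * (- ((-1) ^ n)) / of_nat n)"
  have d: "diffs c n * x ^ n = (z gchoose Suc n) * (- x) ^ n" for n
    unfolding diffs_def c_def by (simp add: power_minus[of x] del: of_nat_Suc)
  have "((\<lambda>x. \<Sum>n. c n * x ^ n) has_field_derivative (\<Sum>n. diffs c n * x ^ n)) (at x)"
    by (rule DERIV_powser) (use F_eq_powser(2) assms in \<open>simp_all add: c_def\<close>)
  then have "((\<lambda>x. \<Sum>n. c n * x ^ n) has_field_derivative gbinomial_quotient z (- x)) (at x)"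
    unfolding d gbinomial_quotient_def .
  then show ?thesis
    by (rule has_field_derivative_transform_within_open[of _ _ _ "ball 0 1"])
       (use assms F_eq_powser(1) in \<open>auto simp: c_def\<close>)
qed

section \<open>The harmonic binomial series and its differential equation\<close>

text \<open>A crude bound suffices: a factor n is exactly what differentiating the binomial series
  produces.\<close>

lemma norm_harm_le: "norm (harm n :: complex) \<le> real n"
proof (induction n)
  case (Suc n)
  have "norm (harm (Suc n) :: complex) \<le> norm (harm n :: complex) + norm (inverse (of_nat (Suc n)) :: complex)"
    unfolding harm_Suc by (rule norm_triangle_ineq)
  also have "norm (inverse (of_nat (Suc n)) :: complex) \<le> 1"
    unfolding norm_inverse norm_of_nat by (simp add: field_simps)
  finally show ?case using Suc by simp
qed (simp add: harm_def)

text \<open>Dominated by |x| times the absolutely convergent derivative of the binomial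
  series.\<close>

lemma summable_harm_gbinomial:
  fixes z x :: complex
  assumes "norm x < 1"
  shows "summable (\<lambda>n. ((z gchoose n) * harm n) * x ^ n)"
proof -
  have "summable (\<lambda>n. norm (diffs ((gchoose) z) n * x ^ n))"
    by (rule summable_norm_powser[OF summable_diffs_powser[OF summable_gbinomial] assms])
  then have s: "summable (\<lambda>n. norm (diffs ((gchoose) z) n * x ^ n) * norm x)"
    by (rule summable_mult2)
  have "summable (\<lambda>n. ((z gchoose Suc n) * harm (Suc n)) * x ^ Suc n)"
  proof (rule summable_comparison_test'[OF s])
    fix n
    have "norm (z gchoose Suc n) * norm (harm (Suc n) :: complex) \<le> norm (z gchoose Suc n) * real (Suc n)"
      by (intro mult_left_mono norm_harm_le) simp
    then have "norm (z gchoose Suc n) * norm (harm (Suc n) :: complex) * norm x ^ Suc n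
        \<le> norm (z gchoose Suc n) * real (Suc n) * norm x ^ Suc n"
      by (intro mult_right_mono) auto
    then show "norm ((z gchoose Suc n) * harm (Suc n) * x ^ Suc n) \<le> norm (diffs ((gchoose) z) n * x ^ n) * norm x"
      unfolding diffs_def norm_mult norm_power norm_of_nat by (simp add: mult_ac del: of_nat_Suc)
  qed
  then show ?thesis by (subst (asm) summable_Suc_iff)
qed

lemma sums_harm_binomial_series:
  assumes "norm x < 1"
  shows "(\<lambda>k. (z gchoose Suc k) * harm (Suc k) * x ^ Suc k) sums harm_binomial_series z x"
  using summable_sums[OF summable_harm_gbinomial[OF assms, of z]]
  unfolding harm_binomial_series_def by (subst sums_Suc_iff) (simp add: harm_def)

lemma harm_binomial_series_0: "harm_binomial_series z 0 = 0"
  unfolding harm_binomial_series_def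
  using powser_zero[of "\<lambda>n. (z gchoose n) * harm n"] by (simp add: harm_def)

text \<open>Compare coefficients, using (n+1) C(z,n+1) = (z-n) C(z,n) and H_(n+1) = H_n + 1/(n+1);
  the increment 1/(n+1) yields the inhomogeneous term.\<close>

lemma harm_binomial_series_ode:
  assumes "norm x < 1"
  obtains D where "(harm_binomial_series z has_field_derivative D) (at x)"
    and "(1 + x) * D = z * harm_binomial_series z x + gbinomial_quotient z x"
proof
  define c where "c = (\<lambda>n. (z gchoose n) * harm n)"
  let ?D = "\<Sum>n. diffs c n * x ^ n"
  have G: "harm_binomial_series z = (\<lambda>x. \<Sum>n. c n * x ^ n)"
    unfolding harm_binomial_series_def c_def by (rule refl)
  have sc: "summable (\<lambda>n. c n * x ^ n)" if "norm x < 1" for x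
    unfolding c_def using summable_harm_gbinomial[OF that] .
  show "(harm_binomial_series z has_field_derivative ?D) (at x)"
    unfolding G using DERIV_powser[OF sc assms] .
  have sd: "summable (\<lambda>n. diffs c n * x ^ n)" by (rule summable_diffs_powser[OF sc assms])
  have s1: "(\<lambda>n. diffs c n * x ^ n) sums ?D" using sd by (rule summable_sums)
  have "(\<lambda>n. x * (of_nat n * c n * x ^ (n - Suc 0))) sums (x * ?D)"
    by (rule sums_mult[OF diffs_equiv[OF sd]])
  moreover have "x * (of_nat n * c n * x ^ (n - Suc 0)) = of_nat n * c n * x ^ n" for n
    by (cases n) auto
  ultimately have "(\<lambda>n. of_nat n * c n * x ^ n) sums (x * ?D)" by simp
  from sums_add[OF s1 this]
  have l: "(\<lambda>n. diffs c n * x ^ n + of_nat n * c n * x ^ n) sums (?D + x * ?D)" .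
  have r: "(\<lambda>n. z * (c n * x ^ n) + (z gchoose Suc n) * x ^ n) sums
      (z * harm_binomial_series z x + gbinomial_quotient z x)"
    unfolding G gbinomial_quotient_def
    by (intro sums_add sums_mult summable_sums sc summable_gbinomial_quotient assms)
  have "diffs c n * x ^ n + of_nat n * c n * x ^ n = z * (c n * x ^ n) + (z gchoose Suc n) * x ^ n" for n
  proof -
    \<comment> \<open>The part \<open>- of_nat n\<close> will cancel against the coefficient coming
      from x times the derivative.\<close>
    have a: "of_nat (Suc n) * (z gchoose Suc n) = (z - of_nat n) * (z gchoose n)"
      by (simp only: gbinomial_absorption gbinomial_absorb_comp)
    have "diffs c n = of_nat (Suc n) * (z gchoose Suc n) * harm n
        + (of_nat (Suc n) * inverse (of_nat (Suc n))) * (z gchoose Suc n)"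
      unfolding diffs_def c_def harm_Suc by (simp add: algebra_simps del: of_nat_Suc)
    also have "\<dots> = (z - of_nat n) * c n + (z gchoose Suc n)"
      unfolding a c_def by (simp del: of_nat_Suc)
    finally have "diffs c n + of_nat n * c n = z * c n + (z gchoose Suc n)"
      by (simp add: algebra_simps)
    then have "(diffs c n + of_nat n * c n) * x ^ n = (z * c n + (z gchoose Suc n)) * x ^ n" by simp
    then show ?thesis by (simp only: distrib_right mult.assoc)
  qed
  then have "?D + x * ?D = z * harm_binomial_series z x + gbinomial_quotient z x"
    using sums_unique2[OF l] r by simp
  then show "(1 + x) * ?D = z * harm_binomial_series z x + gbinomial_quotient z x"
    by (simp add: algebra_simps)
qed

text \<open>The power (1+x)^(-z) is an integrating factor for the equation (1+x) G' = z G +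
  B.\<close>

lemma DERIV_powr_harm_binomial_series:
  assumes "norm x < 1"
  shows "((\<lambda>x. (1 + x) powr (- z) * harm_binomial_series z x) has_field_derivative
           (1 + x) powr (- z - 1) * gbinomial_quotient z x) (at x)"
proof -
  obtain D where D: "(harm_binomial_series z has_field_derivative D) (at x)"
    and e: "(1 + x) * D = z * harm_binomial_series z x + gbinomial_quotient z x"
    by (rule harm_binomial_series_ode[OF assms])
  note n = one_plus_notin_nonpos_Reals[OF assms]
  then have "1 + x \<noteq> 0" by auto
  then have p: "(1 + x) powr (- z) = (1 + x) powr (- z - 1) * (1 + x)"
    by (simp add: powr_diff)
  show ?thesis
    by (rule derivative_eq_intros D n refl)+
       (use e in \<open>simp add: p, algebra\<close>)
qed

section \<open>The substitution x/(1+x) and the first identity\<close>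

text \<open>The hypothesis says that x is closer to 0 than to -1, since |1+x|^2 - |x|^2 = 1 + 2 Re
  x.\<close>

lemma norm_divide_one_plus_less:
  fixes x :: complex
  assumes "Re x > - (1/2)"
  shows "norm (x / (1 + x)) < 1"
proof -
  have "1 + x \<noteq> 0" using assms by (auto simp: complex_eq_iff)
  moreover have "(norm x)\<^sup>2 < (norm (1 + x))\<^sup>2"
    using assms unfolding cmod_power2 by (simp add: power2_eq_square algebra_simps)
  then have "norm x < norm (1 + x)" by (rule power2_less_imp_less) simp
  ultimately show ?thesis by (simp add: norm_divide)
qed

text \<open>A positive real part keeps w off the branch cut, where \<open>Ln (inverse w)\<close> is
  \<open>- Ln w\<close>.\<close>

lemma powr_inverse_complex:
  fixes w :: complex
  assumes "Re w > 0"
  shows "inverse w powr z = w powr (- z)"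
proof -
  have "w \<noteq> 0" using assms by auto
  moreover have "w \<notin> \<real>\<^sub>\<le>\<^sub>0" using assms by (auto simp: complex_nonpos_Reals_iff)
  ultimately show ?thesis by (simp add: powr_def Ln_inverse)
qed

lemma harm_binomial_series_eq_F:
  assumes x: "norm x < 1" "Re x > - (1/2)"
  shows "(1 + x) powr (- z) * harm_binomial_series z x = F z (x / (1 + x))"
proof -
  define S where "S = ball (0::complex) 1 \<inter> {x. Re x > - (1/2)}"
  define f where "f = (\<lambda>x. (1 + x) powr (- z) * harm_binomial_series z x - F z (x / (1 + x)))"
  have "\<exists>c. \<forall>x\<in>S. f x = c"
  proof (rule has_field_derivative_zero_constant)
    show "convex S" unfolding S_def by (intro convex_Int convex_ball convex_halfspace_Re_gt)
    fix x assume "x \<in> S"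
    then have x: "norm x < 1" "Re x > - (1/2)" by (auto simp: S_def)
    let ?u = "x / (1 + x)"
    have u: "norm ?u < 1" using norm_divide_one_plus_less[OF x(2)] .
    have nz: "1 + x \<noteq> 0" using x(2) by (auto simp: complex_eq_iff)
    have "((\<lambda>x. x / (1 + x)) has_field_derivative 1 / (1 + x)\<^sup>2) (at x)"
      by (rule derivative_eq_intros refl nz)+ (use nz in \<open>simp add: power2_eq_square\<close>)
    from DERIV_chain2[OF DERIV_F[OF u] this]
    have dF: "((\<lambda>x. F z (x / (1 + x))) has_field_derivative
        gbinomial_quotient z (- ?u) * (1 / (1 + x)\<^sup>2)) (at x)" .
    have "(1 + x) powr (- z - 1) * gbinomial_quotient z x = gbinomial_quotient z (- ?u) * (1 / (1 + x)\<^sup>2)"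
    \<comment> \<open>Away from 0 the quotients are known only after multiplication by their
      arguments, so both sides are compared after multiplying by x(1+x). The link is 1 - u = 1/(1+x)
      for u = x/(1+x).\<close>
    proof (cases "x = 0")
      case False
      have "1 + - ?u = inverse (1 + x)" using nz by (simp add: field_simps)
      then have "(1 + - ?u) powr z = (1 + x) powr (- z)"
        using powr_inverse_complex[of "1 + x" z] x(2) by simp
      then have a: "- ?u * gbinomial_quotient z (- ?u) = (1 + x) powr (- z) - 1"
        using gbinomial_quotient_mult[of "- ?u" z] u by simp
      have b: "x * gbinomial_quotient z x = (1 + x) powr z - 1"
        using gbinomial_quotient_mult[OF x(1)] .
      have p: "(1 + x) powr (- z - 1) * (1 + x) = (1 + x) powr (- z)"
        "(1 + x) powr (- z) * (1 + x) powr z = 1"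
        using nz by (simp_all add: powr_diff powr_minus)
      have "x * (1 + x) * ((1 + x) powr (- z - 1) * gbinomial_quotient z x)
          = ((1 + x) powr (- z - 1) * (1 + x)) * (x * gbinomial_quotient z x)" by (simp add: mult_ac)
      also have "\<dots> = 1 - (1 + x) powr (- z)" unfolding p b using p(2) by (simp add: algebra_simps)
      also have "\<dots> = ?u * gbinomial_quotient z (- ?u)" using a by (simp add: algebra_simps)
      also have "\<dots> = x * (1 + x) * (gbinomial_quotient z (- ?u) * (1 / (1 + x)\<^sup>2))"
        using nz by (simp add: power2_eq_square)
      finally show ?thesis by (simp only: mult_cancel_left mult_eq_0_iff False nz simp_thms)
    qed simp
    with DERIV_diff[OF DERIV_powr_harm_binomial_series[OF x(1), of z] dF]
    have "(f has_field_derivative 0) (at x)" unfolding f_def by simp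
    then show "(f has_field_derivative 0) (at x within S)" by (rule has_field_derivative_at_within)
  qed
  moreover have "0 \<in> S" "x \<in> S" using x by (auto simp: S_def)
  ultimately have "f x = f 0" by metis
  then show ?thesis by (simp add: f_def harm_binomial_series_0 F_0)
qed

section \<open>Reflection to -z-1 and -x, for the third identity\<close>

text \<open>The logarithm enters because (1-x)^z (1-x)^(-z-1) = 1/(1-x): this is the part by which
  the derivatives of the two series differ.\<close>

lemma harm_binomial_series_reflect:
  assumes x: "norm x < 1"
  shows "(1 - x) powr (z + 1) * harm_binomial_series (- z - 1) (- x) = F z x - Ln (1 - x)"
proof -
  define S where "S = ball (0::complex) 1"
  \<comment> \<open>The exponent is z + 1, left unsimplified to match the integrating factor at
    index -z-1.\<close>
  define h where "h = (\<lambda>y. (1 + y) powr (- (- z - 1)) * harm_binomial_series (- z - 1) y)"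
  define f where "f = (\<lambda>x. h (- x) - F z x + Ln (1 - x))"
  have "\<exists>c. \<forall>x\<in>S. f x = c"
  proof (rule has_field_derivative_zero_constant)
    show "convex S" unfolding S_def by (rule convex_ball)
    fix x assume "x \<in> S"
    then have x: "norm x < 1" by (auto simp: S_def)
    have n: "1 - x \<notin> \<real>\<^sub>\<le>\<^sub>0" using one_plus_notin_nonpos_Reals[of "- x"] x by simp
    then have nz: "1 - x \<noteq> 0" by auto
    have "(h has_field_derivative (1 + - x) powr (- (- z - 1) - 1) * gbinomial_quotient (- z - 1) (- x)) (at (- x))"
      unfolding h_def by (rule DERIV_powr_harm_binomial_series) (use x in simp)
    from DERIV_chain2[OF this DERIV_minus[OF DERIV_ident]]
    have "((\<lambda>x. h (- x)) has_field_derivative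
        (1 - x) powr z * gbinomial_quotient (- z - 1) (- x) * (- 1)) (at x)"
      by simp
    moreover have "((\<lambda>x. Ln (1 - x)) has_field_derivative (- 1 / (1 - x))) (at x)"
      by (rule derivative_eq_intros refl n)+ (simp add: divide_inverse)
    ultimately have df: "(f has_field_derivative (1 - x) powr z * gbinomial_quotient (- z - 1) (- x) * (- 1)
        - gbinomial_quotient z (- x) + - 1 / (1 - x)) (at x)"
      unfolding f_def by (intro DERIV_add DERIV_diff DERIV_F x)
    have "(1 - x) powr z * gbinomial_quotient (- z - 1) (- x) * (- 1)
        - gbinomial_quotient z (- x) + - 1 / (1 - x) = 0"
    proof (cases "x = 0")
      case False
      have a: "- x * gbinomial_quotient (- z - 1) (- x) = (1 - x) powr (- z - 1) - 1"
        using gbinomial_quotient_mult[of "- x" "- z - 1"] x by simp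
      have b: "- x * gbinomial_quotient z (- x) = (1 - x) powr z - 1"
        using gbinomial_quotient_mult[of "- x" z] x by simp
      have p: "(1 - x) powr z * (1 - x) powr (- z - 1) = 1 / (1 - x)"
        using nz by (simp add: powr_diff powr_minus field_simps)
      have "x * ((1 - x) powr z * gbinomial_quotient (- z - 1) (- x) * (- 1)
          - gbinomial_quotient z (- x) + - 1 / (1 - x))
          = (1 - x) powr z * (- x * gbinomial_quotient (- z - 1) (- x))
            + (- x * gbinomial_quotient z (- x)) - x / (1 - x)" by (simp add: algebra_simps)
      also have "\<dots> = 1 / (1 - x) - 1 - x / (1 - x)"
        unfolding a b right_diff_distrib p by simp
      also have "\<dots> = 0" using nz by (simp add: field_simps)
      finally show ?thesis using False by simp
    qed (simp add: gbinomial_quotient_0)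
    with df show "(f has_field_derivative 0) (at x within S)"
      by (metis has_field_derivative_at_within)
  qed
  moreover have "0 \<in> S" "x \<in> S" using x by (auto simp: S_def)
  ultimately have "f x = f 0" by metis
  then have "h (- x) - F z x + Ln (1 - x) = 0"
    by (simp add: f_def h_def harm_binomial_series_0 F_0)
  then have "h (- x) = F z x - Ln (1 - x)" by algebra
  then show ?thesis by (simp add: h_def add.commute)
qed

section \<open>The series for the digamma function and its Abel limit\<close>

text \<open>These are the terms of the classical series for psi(z+1) + gamma.\<close>

definition digamma_coeff :: "complex \<Rightarrow> nat \<Rightarrow> complex" where
  "digamma_coeff z n = inverse (of_nat (Suc n)) - inverse (z + 1 + of_nat n)"

text \<open>With m = n + 1 the term equals z/(m(z+m)), and |z+m| is at least m/2 once m >= 2|z|, so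
  the terms decay like 1/m^2.\<close>

lemma summable_norm_digamma_coeff: "summable (\<lambda>n. norm (digamma_coeff z n))"
proof (rule summable_comparison_test_ev)
  obtain N :: nat where N: "2 * norm z \<le> real N" using real_arch_simple by blast
  show "\<forall>\<^sub>F n in sequentially.
      norm (norm (digamma_coeff z n)) \<le> 2 * norm z * (1 / real (Suc n) ^ 2)"
    using eventually_ge_at_top[of N]
  proof eventually_elim
    case (elim n)
    define m where "m = real (Suc n)"
    have m: "m > 0" "2 * norm z \<le> m" using N elim by (auto simp: m_def)
    have e: "z + 1 + of_nat n = z + of_real m" by (simp add: m_def)
    have "m - norm z \<le> norm (of_real m + z)"
      using norm_diff_ineq[of "of_real m :: complex" z] m(1) by simp
    then have b: "m / 2 \<le> norm (z + of_real m)" using m(2) by (simp add: add.commute)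
    then have nz: "z + of_real m \<noteq> 0" using m(1) by auto
    have "digamma_coeff z n = inverse (of_real m) - inverse (z + of_real m)"
      unfolding digamma_coeff_def e by (simp add: m_def)
    also have "\<dots> = z / (of_real m * (z + of_real m))"
      using nz m(1) by (simp add: field_simps)
    finally have "norm (digamma_coeff z n) = norm z / (m * norm (z + of_real m))"
      using m(1) by (simp add: norm_divide norm_mult)
    also have "\<dots> \<le> norm z / (m * (m / 2))"
      using b m(1) by (intro divide_left_mono mult_left_mono mult_pos_pos) auto
    also have "\<dots> = 2 * norm z * (1 / m ^ 2)" by (simp add: power2_eq_square)
    finally show ?case by (simp add: m_def)
  qed
  have "summable (\<lambda>n. inverse (real (Suc n) ^ 2))"
    using inverse_squares_sums by (auto simp: sums_iff field_simps)
  then show "summable (\<lambda>n. 2 * norm z * (1 / real (Suc n) ^ 2))"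
    by (intro summable_mult) (simp add: field_simps)
qed

lemma sums_digamma_coeff:
  assumes "z + 1 \<noteq> 0"
  shows "digamma_coeff z sums (Digamma (z + 1) + euler_mascheroni)"
  using summable_sums[OF summable_Digamma[OF assms]]
  by (simp add: digamma_coeff_def[abs_def] Digamma_def)

text \<open>Absolute convergence at v = 1 makes the series uniformly convergent on [0,1] by the
  Weierstrass test, hence continuous up to the endpoint.\<close>

lemma tendsto_digamma_series:
  assumes "z + 1 \<noteq> 0"
  shows "((\<lambda>v. \<Sum>n. digamma_coeff z n * of_real v ^ n) \<longlongrightarrow>
           Digamma (z + 1) + euler_mascheroni) (at_left 1)"
proof -
  let ?A = "\<lambda>v::real. \<Sum>n. digamma_coeff z n * of_real v ^ n"
  have "uniform_limit {0..1} (\<lambda>N (v::real). \<Sum>n<N. digamma_coeff z n * of_real v ^ n) ?A sequentially"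
  proof (rule Weierstrass_m_test)
    fix n and v :: real assume "v \<in> {0..1}"
    then show "norm (digamma_coeff z n * of_real v ^ n) \<le> norm (digamma_coeff z n)"
      by (simp add: norm_mult norm_power mult_left_le power_le_one)
  qed (rule summable_norm_digamma_coeff)
  then have "continuous_on {0..1} ?A"
    by (rule uniform_limit_theorem[rotated]) (auto intro!: always_eventually continuous_intros)
  then have "(?A \<longlongrightarrow> ?A 1) (at 1 within {0..1})" unfolding continuous_on_def by (rule bspec) simp
  moreover have "?A 1 = Digamma (z + 1) + euler_mascheroni"
    using sums_unique[OF sums_digamma_coeff[OF assms]] by simp
  ultimately show ?thesis by (simp add: at_within_Icc_at_left)
qed

section \<open>The shifted logarithmic series\<close>

text \<open>Multiplied by v^(z+1) this is the sum of v^(n+z)/(n+z) over n >= 1. Keeping the complex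
  power outside leaves a genuine power series.\<close>

definition shifted_log_series :: "complex \<Rightarrow> complex \<Rightarrow> complex" where
  "shifted_log_series z v = (\<Sum>n. inverse (z + 1 + of_nat n) * v ^ n)"

text \<open>Split 1/(z+1+n) into 1/(n+1) minus \<open>digamma_coeff z n\<close>; the first part sums
  to the logarithm and carries the whole singularity at v = 1.\<close>

lemma shifted_log_series_summable:
  fixes v :: complex
  assumes "norm v < 1"
  shows "summable (\<lambda>n. inverse (z + 1 + of_nat n) * v ^ n)"
    and "v * shifted_log_series z v = - Ln (1 - v) - v * (\<Sum>n. digamma_coeff z n * v ^ n)"
proof -
  have a: "summable (\<lambda>n. digamma_coeff z n * v ^ n)"
  proof (rule summable_comparison_test'[OF summable_norm_digamma_coeff])
    show "norm (digamma_coeff z n * v ^ n) \<le> norm (digamma_coeff z n)" for n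
      using assms by (simp add: norm_mult norm_power mult_left_le power_le_one)
  qed
  have l: "summable (\<lambda>n. inverse (of_nat (Suc n)) * v ^ n)"
  proof (rule summable_comparison_test')
    show "summable (\<lambda>n. norm v ^ n)" using assms by simp
    show "norm (inverse (of_nat (Suc n)) * v ^ n) \<le> norm v ^ n" for n
      unfolding norm_mult norm_inverse norm_of_nat norm_power
      by (intro mult_left_le_one_le) (auto simp: field_simps)
  qed
  have e: "inverse (of_nat (Suc n)) * v ^ n - digamma_coeff z n * v ^ n
      = inverse (z + 1 + of_nat n) * v ^ n" for n
    by (simp add: digamma_coeff_def algebra_simps)
  show "summable (\<lambda>n. inverse (z + 1 + of_nat n) * v ^ n)"
    using summable_diff[OF l a] unfolding e .
  have "(\<lambda>n. - (v ^ n) / of_nat n) sums Ln (1 - v)"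
    using Ln_series'[of "- v"] assms by simp
  \<comment> \<open>The omitted term at n = 0 is a division by zero, hence 0.\<close>
  then have "(\<lambda>n. - (v ^ Suc n) / of_nat (Suc n)) sums Ln (1 - v)"
    by (subst sums_Suc_iff) simp
  then have "(\<lambda>n. v * (inverse (of_nat (Suc n)) * v ^ n)) sums - Ln (1 - v)"
    using sums_minus by (force simp: field_simps)
  moreover have "(\<lambda>n. v * (inverse (of_nat (Suc n)) * v ^ n)) sums
      (v * (\<Sum>n. inverse (of_nat (Suc n)) * v ^ n))"
    by (intro sums_mult summable_sums l)
  ultimately have "v * (\<Sum>n. inverse (of_nat (Suc n)) * v ^ n) = - Ln (1 - v)"
    by (rule sums_unique2[symmetric])
  moreover have "shifted_log_series z v
      = (\<Sum>n. inverse (of_nat (Suc n)) * v ^ n) - (\<Sum>n. digamma_coeff z n * v ^ n)"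
    unfolding shifted_log_series_def suminf_diff[OF l a] e ..
  ultimately show "v * shifted_log_series z v = - Ln (1 - v) - v * (\<Sum>n. digamma_coeff z n * v ^ n)"
    by (simp add: right_diff_distrib)
qed

text \<open>Formally each v^(n+z+1)/(n+z+1) differentiates to v^(n+z), leaving v^z times a geometric
  series. In terms of Q, the series without the power, this is (z+1) Q + v Q' = 1/(1-v).\<close>

lemma DERIV_powr_shifted_log_series:
  assumes v: "norm v < 1" "v \<notin> \<real>\<^sub>\<le>\<^sub>0" and z: "\<And>n. z + 1 + of_nat n \<noteq> 0"
  shows "((\<lambda>v. v powr (z + 1) * shifted_log_series z v) has_field_derivative
           v powr z / (1 - v)) (at v)"
proof -
  define c where "c = (\<lambda>n. inverse (z + 1 + of_nat n))"
  let ?D = "\<Sum>n. diffs c n * v ^ n"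
  have Q: "shifted_log_series z = (\<lambda>v. \<Sum>n. c n * v ^ n)"
    unfolding shifted_log_series_def c_def by (rule refl)
  have sc: "summable (\<lambda>n. c n * v ^ n)" if "norm v < 1" for v
    unfolding c_def using shifted_log_series_summable(1)[OF that] .
  have d: "(shifted_log_series z has_field_derivative ?D) (at v)"
    unfolding Q using DERIV_powser[OF sc v(1)] .
  have "(\<lambda>n. (z + 1) * (c n * v ^ n)) sums ((z + 1) * shifted_log_series z v)"
    unfolding Q by (intro sums_mult summable_sums sc v)
  from sums_add[OF this sums_mult[OF diffs_equiv[OF summable_diffs_powser[OF sc v(1)]], of v]]
  have "(\<lambda>n. (z + 1) * (c n * v ^ n) + v * (of_nat n * c n * v ^ (n - Suc 0))) sums
      ((z + 1) * shifted_log_series z v + v * ?D)" by simp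
  moreover have "(z + 1) * (c n * v ^ n) + v * (of_nat n * c n * v ^ (n - Suc 0)) = v ^ n" for n
  proof -
    have "v * (of_nat n * c n * v ^ (n - Suc 0)) = of_nat n * c n * v ^ n"
      by (cases n) auto
    then have "(z + 1) * (c n * v ^ n) + v * (of_nat n * c n * v ^ (n - Suc 0))
        = (z + 1 + of_nat n) * c n * v ^ n" by (simp only: distrib_right mult.assoc)
    then show ?thesis unfolding c_def using z[of n] by simp
  qed
  ultimately have "(\<lambda>n. v ^ n) sums ((z + 1) * shifted_log_series z v + v * ?D)" by simp
  then have ode: "(z + 1) * shifted_log_series z v + v * ?D = 1 / (1 - v)"
    using geometric_sums[OF v(1)] by (rule sums_unique2)
  have "v \<noteq> 0" using v by auto
  then have p: "v powr (z + 1) = v powr z * v" by (simp add: powr_add)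
  have "((\<lambda>v. v powr (z + 1) * shifted_log_series z v) has_field_derivative
      v powr z * ((z + 1) * shifted_log_series z v + v * ?D)) (at v)"
    by (rule derivative_eq_intros d v refl)+ (simp add: p, simp add: algebra_simps)
  then show ?thesis unfolding ode by simp
qed

section \<open>The limit v -> 1 and the value of the constant\<close>

text \<open>The difference quotient of v^z at 1 has a finite limit, while (v-1) log(1-v) tends to
  0.\<close>

lemma tendsto_powr_minus_one_mult_ln:
  fixes z :: complex
  shows "((\<lambda>v. (of_real v powr z - 1) * of_real (ln (1 - v))) \<longlongrightarrow> 0) (at_left 1)"
proof -
  have "((\<lambda>y. (y powr z - 1 powr z) / (y - 1)) \<longlongrightarrow> z * 1 powr (z - 1)) (at (1::complex))"
    using has_field_derivative_powr[of 1 z] by (simp add: has_field_derivative_iff)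
  moreover have "filterlim complex_of_real (at 1) (at_left 1)"
    unfolding filterlim_at
    by (auto intro!: tendsto_eq_intros eventually_at_leftI[of 0])
  ultimately have a: "((\<lambda>v. (of_real v powr z - 1 powr z) / (of_real v - 1)) \<longlongrightarrow> z * 1 powr (z - 1)) (at_left (1::real))"
    by (rule filterlim_compose)
  have "((\<lambda>v::real. (v - 1) * ln (1 - v)) \<longlongrightarrow> 0) (at_left 1)" by real_asymp
  then have "((\<lambda>v::real. complex_of_real ((v - 1) * ln (1 - v))) \<longlongrightarrow> of_real 0) (at_left 1)"
    by (rule tendsto_of_real)
  from tendsto_mult[OF a this]
  have "((\<lambda>v. (of_real v powr z - 1 powr z) / (of_real v - 1) * complex_of_real ((v - 1) * ln (1 - v)))
      \<longlongrightarrow> 0) (at_left 1)" by simp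
  then show ?thesis
  proof (rule Lim_transform_eventually)
    show "\<forall>\<^sub>F v in at_left 1. (of_real v powr z - 1 powr z) / (of_real v - 1) * complex_of_real ((v - 1) * ln (1 - v))
        = (of_real v powr z - 1) * of_real (ln (1 - v))"
    proof (rule eventually_at_leftI)
      fix v :: real assume "v \<in> {0<..<1}"
      then have "complex_of_real v - 1 \<noteq> 0" by auto
      then show "(of_real v powr z - 1 powr z) / (of_real v - 1) * complex_of_real ((v - 1) * ln (1 - v))
        = (of_real v powr z - 1) * of_real (ln (1 - v))" by simp
    qed simp
  qed
qed

lemma F_one_minus_eq_Digamma:
  fixes z :: complex and v :: real
  assumes v: "0 < v" "v < 1" and z: "\<And>n. z + 1 + of_nat n \<noteq> 0"
  shows "F z (of_real (1 - v)) = Digamma (z + 1) + euler_mascheroni + of_real (ln (1 - v))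
           + of_real v powr (z + 1) * shifted_log_series z (of_real v)"
proof -
  \<comment> \<open>This lens is convex and contains the interval (0,1); on it both series converge
    and neither v nor 1-v meets the branch cut.\<close>
  define S where "S = ball (0::complex) 1 \<inter> ball 1 1"
  define f where "f = (\<lambda>v. F z (1 - v) - Ln (1 - v) - v powr (z + 1) * shifted_log_series z v)"
  have "\<exists>c. \<forall>x\<in>S. f x = c"
  proof (rule has_field_derivative_zero_constant)
    show "convex S" unfolding S_def by (intro convex_Int convex_ball)
    fix v assume "v \<in> S"
    then have v: "norm v < 1" "norm (1 - v) < 1" by (auto simp: S_def dist_norm)
    have n1: "1 - v \<notin> \<real>\<^sub>\<le>\<^sub>0" using one_plus_notin_nonpos_Reals[of "- v"] v by simp
    have n0: "v \<notin> \<real>\<^sub>\<le>\<^sub>0" using one_plus_notin_nonpos_Reals[of "v - 1"] v by (simp add: norm_minus_commute)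
    have nz: "1 - v \<noteq> 0" using n1 by auto
    have "((\<lambda>v. 1 - v) has_field_derivative - 1) (at v)" by (auto intro!: derivative_eq_intros)
    from DERIV_chain2[OF DERIV_F[OF v(2)] this]
    have "((\<lambda>v. F z (1 - v)) has_field_derivative - gbinomial_quotient z (v - 1)) (at v)" by simp
    moreover have "((\<lambda>v. Ln (1 - v)) has_field_derivative (- 1 / (1 - v))) (at v)"
      by (rule derivative_eq_intros refl n1)+ (simp add: divide_inverse)
    ultimately have "(f has_field_derivative
        - gbinomial_quotient z (v - 1) - - 1 / (1 - v) - v powr z / (1 - v)) (at v)"
      unfolding f_def by (intro DERIV_diff DERIV_powr_shifted_log_series z n0 v)
    moreover have "(v - 1) * gbinomial_quotient z (v - 1) = v powr z - 1"
      using gbinomial_quotient_mult[of "v - 1" z] v(2) by (simp add: norm_minus_commute)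
    then have "- gbinomial_quotient z (v - 1) - - 1 / (1 - v) - v powr z / (1 - v) = 0"
      using nz by (simp add: field_simps)
    ultimately show "(f has_field_derivative 0) (at v within S)"
      by (metis has_field_derivative_at_within)
  qed
  then obtain c where c: "\<And>v. v \<in> S \<Longrightarrow> f v = c" by blast
  have S: "of_real v \<in> S" if "0 < v" "v < 1" for v
  proof -
    have "norm (1 - complex_of_real v) = \<bar>1 - v\<bar>"
      by (metis norm_of_real of_real_1 of_real_diff)
    then show ?thesis using that by (simp add: S_def dist_norm)
  qed
  have Ln1: "Ln (1 - of_real v) = of_real (ln (1 - v))" if "v < 1" for v
    using Ln_of_real[of "1 - v"] that by simp
  let ?A = "\<lambda>v::real. \<Sum>n. digamma_coeff z n * of_real v ^ n"
  \<comment> \<open>On (0,1) this is f with the shifted series split as above: the two logarithms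
    merge into (v^z - 1) log(1-v), so every summand has a limit at 1.\<close>
  let ?g = "\<lambda>v::real. F z (of_real (1 - v)) + (of_real v powr z - 1) * of_real (ln (1 - v))
      + of_real v powr (z + 1) * ?A v"
  have fg: "?g v = c" if v: "0 < v" "v < 1" for v
  proof -
    have p: "complex_of_real v powr (z + 1) = of_real v powr z * of_real v"
      using v(1) by (simp add: powr_add)
    have "complex_of_real v * shifted_log_series z (of_real v) = - of_real (ln (1 - v)) - of_real v * ?A v"
      using shifted_log_series_summable(2)[of "of_real v" z] v Ln1[of v] by simp
    then have "complex_of_real v powr (z + 1) * shifted_log_series z (of_real v)
        = of_real v powr z * (- of_real (ln (1 - v)) - of_real v * ?A v)"
      unfolding p by (simp add: mult.assoc)
    then have "f (of_real v) = ?g v"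
      unfolding f_def p Ln1[OF v(2)] by (simp add: algebra_simps)
    then show ?thesis using c[OF S[OF v]] by simp
  qed
  have "(?g \<longlongrightarrow> F z (of_real (1 - 1)) + 0 + of_real 1 powr (z + 1) * (Digamma (z + 1) + euler_mascheroni)) (at_left 1)"
  proof (intro tendsto_add tendsto_mult tendsto_powr_minus_one_mult_ln)
    have "isCont (F z) (of_real (1 - 1))" using DERIV_F[of 0 z] DERIV_isCont by simp blast
    moreover have "((\<lambda>v. complex_of_real (1 - v)) \<longlongrightarrow> of_real (1 - 1)) (at_left 1)"
      by (intro tendsto_intros)
    ultimately show "((\<lambda>v. F z (of_real (1 - v))) \<longlongrightarrow> F z (of_real (1 - 1))) (at_left 1)"
      by (rule isCont_tendsto_compose)
    have "isCont (\<lambda>v. v powr (z + 1)) (of_real 1 :: complex)"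
      by (intro DERIV_isCont[OF has_field_derivative_powr]) simp
    moreover have "((\<lambda>v. complex_of_real v) \<longlongrightarrow> of_real 1) (at_left 1)"
      by (intro tendsto_intros)
    ultimately show "((\<lambda>v. of_real v powr (z + 1)) \<longlongrightarrow> (of_real 1 :: complex) powr (z + 1)) (at_left (1::real))"
      by (rule isCont_tendsto_compose)
    show "(?A \<longlongrightarrow> Digamma (z + 1) + euler_mascheroni) (at_left 1)"
      by (rule tendsto_digamma_series) (use z[of 0] in simp)
  qed
  moreover have "(?g \<longlongrightarrow> c) (at_left 1)"
  proof (rule tendsto_eventually, rule eventually_at_leftI)
    show "?g v = c" if "v \<in> {0<..<1}" for v using fg that by auto
  qed simp
  \<comment> \<open>Only the digamma term survives, since \<open>F z 0 = 0\<close> and the power of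
    1 is 1.\<close>
  ultimately have "c = Digamma (z + 1) + euler_mascheroni"
    using tendsto_unique[OF trivial_limit_at_left_real] by (fastforce simp: F_0)
  with c[OF S[OF v]] show ?thesis
    unfolding f_def Ln1[OF v(2)] by (simp add: algebra_simps)
qed

section \<open>The three identities at real arguments\<close>

theorem theorem7:
  shows "(\<forall>(z::complex) (x::real). - (1/2) < x \<and> x < 1 \<longrightarrow>
           (\<lambda>k. (z gchoose Suc k) * harm (Suc k) * of_real x ^ Suc k) sums
             (of_real (x + 1) powr z * F z (of_real (x / (x + 1)))))
       \<and> (\<forall>(z::complex) (x::real). 0 < x \<and> x < 1 \<and> z \<notin> {- of_nat m |m. m \<ge> 1} \<longrightarrow>
           summable (\<lambda>k. 1 / (of_real (1 + x) powr (of_nat (Suc k) + z) * (of_nat (Suc k) + z))) \<and>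
           (\<lambda>k. (z gchoose Suc k) * harm (Suc k) * of_real x ^ Suc k) sums
             (of_real (x + 1) powr z *
               (Digamma (z + 1) + euler_mascheroni + of_real (ln (x / (1 + x)))
                + (\<Sum>k. 1 / (of_real (1 + x) powr (of_nat (Suc k) + z) * (of_nat (Suc k) + z))))))
       \<and> (\<forall>(z::complex) (x::real). \<bar>x\<bar> < 1 \<longrightarrow>
           (\<lambda>k. ((of_nat (Suc k) + z) gchoose Suc k) * harm (Suc k) * of_real x ^ Suc k) sums
             (of_real (1 - x) powr (- z - 1) * (F z (of_real x) - of_real (ln (1 - x)))))"
proof (intro conjI allI impI; (elim conjE)?)
  show part1: "(\<lambda>k. (z gchoose Suc k) * harm (Suc k) * of_real x ^ Suc k) sums
      (of_real (x + 1) powr z * F z (of_real (x / (x + 1))))"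
    if x: "- (1/2) < x" "x < 1" for z :: complex and x :: real
  proof -
    have n: "norm (complex_of_real x) < 1" using x by simp
    have "of_real (x + 1) powr z * F z (of_real (x / (x + 1)))
        = of_real (x + 1) powr z * ((1 + of_real x) powr (- z) * harm_binomial_series z (of_real x))"
      using harm_binomial_series_eq_F[OF n, of z] x by (simp add: add.commute)
    also have "\<dots> = harm_binomial_series z (of_real x)"
    proof -
      have "of_real (x + 1) = 1 + complex_of_real x" "1 + complex_of_real x \<noteq> 0"
        using x by (auto simp: complex_eq_iff)
      then show ?thesis by (simp add: powr_minus add.commute)
    qed
    finally show ?thesis using sums_harm_binomial_series[OF n, of z] by simp
  qed
  fix z :: complex and x :: real
  assume x: "0 < x" "x < 1" and z: "z \<notin> {- of_nat m |m. m \<ge> 1}"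
  \<comment> \<open>Chosen so that 1 - v = x/(x+1), the argument of \<open>F\<close> in the first
    identity.\<close>
  define v where "v = 1 / (1 + x)"
  have v: "0 < v" "v < 1" using x by (auto simp: v_def)
  have z': "z + 1 + of_nat n \<noteq> 0" for n
  proof
    assume "z + 1 + of_nat n = 0"
    then have "z + of_nat (Suc n) = 0" by (simp add: add_ac)
    then have "z = - of_nat (Suc n)" by (simp only: eq_neg_iff_add_eq_0)
    moreover have "Suc n \<ge> 1" by simp
    ultimately show False using z by blast
  qed
  have t: "1 / (of_real (1 + x) powr (of_nat (Suc k) + z) * (of_nat (Suc k) + z))
      = of_real v powr (z + 1) * (inverse (z + 1 + of_nat k) * of_real v ^ k)" for k
  proof -
    define w where "w = complex_of_real (1 + x)"
    have w: "w \<noteq> 0" "Re w > 0" using x by (auto simp: w_def complex_eq_iff)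
    have vw: "complex_of_real v = inverse w" by (simp add: v_def w_def field_simps)
    have k: "of_nat (Suc k) + z = (z + 1) + of_nat k" by simp
    have p: "w powr ((z + 1) + of_nat k) = w powr (z + 1) * w ^ k"
      unfolding powr_add[of w "z + 1"] using w by (simp add: powr_nat)
    show ?thesis
      unfolding vw powr_inverse_complex[OF w(2)] w_def[symmetric] k p powr_minus
      by (simp add: divide_inverse power_inverse mult_ac)
  qed
  have s: "summable (\<lambda>n. inverse (z + 1 + of_nat n) * complex_of_real v ^ n)"
    by (rule shifted_log_series_summable) (use v in simp)
  show "summable (\<lambda>k. 1 / (of_real (1 + x) powr (of_nat (Suc k) + z) * (of_nat (Suc k) + z)))"
    unfolding t using s by (rule summable_mult)
  have "1 - v = x / (x + 1)" using x by (simp add: v_def field_simps)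
  then have "F z (of_real (x / (x + 1))) = Digamma (z + 1) + euler_mascheroni + of_real (ln (x / (1 + x)))
      + (\<Sum>k. 1 / (of_real (1 + x) powr (of_nat (Suc k) + z) * (of_nat (Suc k) + z)))"
    unfolding t suminf_mult[OF s]
    using F_one_minus_eq_Digamma[OF v z'] by (simp add: shifted_log_series_def add.commute)
  then show "(\<lambda>k. (z gchoose Suc k) * harm (Suc k) * of_real x ^ Suc k) sums
      (of_real (x + 1) powr z * (Digamma (z + 1) + euler_mascheroni + of_real (ln (x / (1 + x)))
        + (\<Sum>k. 1 / (of_real (1 + x) powr (of_nat (Suc k) + z) * (of_nat (Suc k) + z)))))"
    using part1[of x z] x by simp
next
  fix z :: complex and x :: real
  assume x: "\<bar>x\<bar> < 1"
  then have n: "norm (complex_of_real x) < 1" "norm (- complex_of_real x) < 1" by auto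
  \<comment> \<open>Upper negation gives C(n+z,n) = (-1)^n C(-z-1,n), and the sign moves into the
    power of -x.\<close>
  have "((of_nat (Suc k) + z) gchoose Suc k) * harm (Suc k) * of_real x ^ Suc k
      = ((- z - 1) gchoose Suc k) * harm (Suc k) * (- of_real x) ^ Suc k" for k
  proof -
    have "(- z - 1) gchoose Suc k = (-1) ^ Suc k * ((of_nat (Suc k) + z) gchoose Suc k)"
      by (subst gbinomial_negated_upper) (simp add: algebra_simps)
    moreover have "(- complex_of_real x) ^ Suc k = (-1) ^ Suc k * of_real x ^ Suc k"
      by (rule power_minus)
    moreover have "(-1 :: complex) ^ Suc k * (-1) ^ Suc k = 1"
      by (simp flip: power_mult_distrib)
    ultimately show ?thesis by (simp add: mult_ac del: power_Suc)
  qed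
  then have "(\<lambda>k. ((of_nat (Suc k) + z) gchoose Suc k) * harm (Suc k) * of_real x ^ Suc k) sums
      harm_binomial_series (- z - 1) (- of_real x)"
    using sums_harm_binomial_series[OF n(2), of "- z - 1"] by simp
  also have "harm_binomial_series (- z - 1) (- of_real x)
      = of_real (1 - x) powr (- z - 1) * (F z (of_real x) - of_real (ln (1 - x)))"
  proof -
    define w where "w = complex_of_real (1 - x)"
    have w: "w \<noteq> 0" "w = 1 - of_real x" "Ln w = of_real (ln (1 - x))"
      using x Ln_of_real[of "1 - x"] by (auto simp: w_def)
    \<comment> \<open>Undoes the integrating factor in the reflected identity.\<close>
    have "w powr (- z - 1) * w powr (z + 1) = 1"
      using w(1) by (simp flip: powr_add)
    then have "harm_binomial_series (- z - 1) (- of_real x)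
        = w powr (- z - 1) * (w powr (z + 1) * harm_binomial_series (- z - 1) (- of_real x))"
      by (simp flip: mult.assoc)
    also have "w powr (z + 1) * harm_binomial_series (- z - 1) (- of_real x) = F z (of_real x) - of_real (ln (1 - x))"
      using harm_binomial_series_reflect[OF n(1), of z] unfolding w(2)[symmetric] w(3) .
    finally show ?thesis unfolding w_def .
  qed
  finally show "(\<lambda>k. ((of_nat (Suc k) + z) gchoose Suc k) * harm (Suc k) * of_real x ^ Suc k) sums
      (of_real (1 - x) powr (- z - 1) * (F z (of_real x) - of_real (ln (1 - x))))" .
qed

end
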